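(* Let $(L,\circ,[\cdot,\cdot])$ be a complex 2-dimensional GD algebra. Then $(L,\circ,[\cdot,\cdot])$ is isomorphic to one of the following algebras with basis $e_1,e_2$ (brackets and products not displayed are zero, up to skew-symmetry of the bracket): - $T1(0)$: $[e_1,e_2]=0$ (all operations zero). - $T1(1)$: $[e_1,e_2]=e_1$. - $T2(0)$: $e_2\circ e_2=e_1$. - $T2(1)$: $[e_1,e_2]=e_1$; $e_2\circ e_2=e_1$. - $T3_r$ ($r\in\mathbb C$): $[e_1,e_2]=re_1$; $e_2\circ e_1=-e_1$. - $N1$: $e_1\circ e_1=e_1$, $e_2\circ e_2=e_2$. - $N2$: $e_2\circ e_2=e_2$. - $N3_r$ ($r\in\mathbb C$): $[e_1,e_2]=re_1$; $e_1\circ e_2=e_1$, $e_2\circ e_1=e_1$, $e_2\circ e_2=e_2$. - $N4_r$ ($r\in\mathbb C$): $[e_1,e_2]=re_1$; $e_1\circ e_2=e_1$, $e_2\circ e_2=e_2$. - $N5_r$ ($r\in\mathbb C$): $[e_1,e_2]=re_1$; $e_1\circ e_2=e_1$, $e_2\circ e_2=e_1+e_2$. - $N6_{\ell,r}$ ($\ell\in\mathbb C\setminus\{0,1\}$, $r\in\mathbb C$): $[e_1,e_2]=re_1$; $e_1\circ e_2=e_1$, $e_2\circ e_1=\ell e_1$, $e_2\circ e_2=e_2$. Moreover: (1) $T3_{r_1}\cong T3_{r_2}$ if and only if $r_1=r_2$; (2) $N3_{r_1}\cong N3_{r_2}$ if and only if $r_1=r_2$; (3) $N4_{r_1}\cong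 N4_{r_2}$ if and only if $r_1=r_2$; (4) $N5_{r_1}\cong N5_{r_2}$ if and only if $r_1=r_2$; (5) $N6_{\ell_1,r_1}\cong N6_{\ell_2,r_2}$ if and only if $\ell_1=\ell_2$ and $r_1=r_2$.
   Context: A Novikov algebra is a vector space with a bilinear product $\circ$ satisfying $(x\circ y)\circ z-x\circ(y\circ z)=(y\circ x)\circ z-y\circ(x\circ z)$ and $(x\circ y)\circ z=(x\circ z)\circ y$. A Gelfand--Dorfman (GD) algebra is a triple $(A,\circ,[\cdot,\cdot])$ such that $(A,\circ)$ is a Novikov algebra, $(A,[\cdot,\cdot])$ is a Lie algebra, and for all $x,y,z\in A$: $[x,y\circ z]-[z,y\circ x]+[y,x]\circ z-[y,z]\circ x-y\circ[x,z]=0$. An isomorphism of GD algebras is a linear isomorphism preserving both $\circ$ and $[\cdot,\cdot]$. *)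

theory Defs
  imports "HOL-Analysis.Analysis"
begin

definition bilinear_map ::
    "('k::field \<Rightarrow> 'a::ab_group_add \<Rightarrow> 'a) \<Rightarrow> ('a \<Rightarrow> 'a \<Rightarrow> 'a) \<Rightarrow> bool"
  where "bilinear_map s f \<longleftrightarrow>
    (\<forall>x. Vector_Spaces.linear s s (\<lambda>y. f x y)) \<and> (\<forall>y. Vector_Spaces.linear s s (\<lambda>x. f x y))"

text \<open>The underlying vector space of an algebra is the whole type; addition comes from its
  type class, scalar multiplication from the record.\<close>

record ('k, 'a) gd_struct =
  scal :: "'k \<Rightarrow> 'a \<Rightarrow> 'a"
  mul :: "'a \<Rightarrow> 'a \<Rightarrow> 'a"  (infixl "\<odot>\<index>" 70)
  brk :: "'a \<Rightarrow> 'a \<Rightarrow> 'a"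

locale novikov_algebra =
  fixes A :: "('k::field, 'a::ab_group_add) gd_struct" (structure)
  assumes novikov_vector_space: "vector_space (scal A)"
    and mul_bilinear: "bilinear_map (scal A) (mul A)"
    and left_symmetric:
      "(x \<odot> y) \<odot> z - x \<odot> (y \<odot> z) = (y \<odot> x) \<odot> z - y \<odot> (x \<odot> z)"
    and right_commutative: "(x \<odot> y) \<odot> z = (x \<odot> z) \<odot> y"

locale lie_algebra =
  fixes A :: "('k::field, 'a::ab_group_add) gd_struct" (structure)
  assumes lie_vector_space: "vector_space (scal A)"
    and brk_bilinear: "bilinear_map (scal A) (brk A)"
    and brk_alternating: "brk A x x = 0"
    and jacobi: "brk A x (brk A y z) + brk A y (brk A z x) + brk A z (brk A x y) = 0"

locale gd_algebra = novikov_algebra A + lie_algebra A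
  for A :: "('k::field, 'a::ab_group_add) gd_struct" (structure) +
  assumes gd_compatible:
    "brk A x (y \<odot> z) - brk A z (y \<odot> x) + brk A y x \<odot> z - brk A y z \<odot> x - y \<odot> brk A x z = 0"

definition gd_dim :: "('k::field, 'a::ab_group_add) gd_struct \<Rightarrow> nat"
  where "gd_dim A = vector_space.dim (scal A) UNIV"

locale gd_isomorphism = dom: gd_algebra A + cod: gd_algebra B
  for A :: "('k::field, 'a::ab_group_add) gd_struct"
    and B :: "('k, 'b::ab_group_add) gd_struct" +
  fixes f :: "'a \<Rightarrow> 'b"
  assumes iso_linear: "Vector_Spaces.linear (scal A) (scal B) f"
    and iso_bij: "bij f"
    and iso_mul: "f (mul A x y) = mul B (f x) (f y)"
    and iso_brk: "f (brk A x y) = brk B (f x) (f y)"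

definition gd_isomorphic ::
    "('k::field, 'a::ab_group_add) gd_struct \<Rightarrow> ('k, 'b::ab_group_add) gd_struct \<Rightarrow> bool"
    (infix "\<cong>" 50)
  where "A \<cong> B \<longleftrightarrow> (\<exists>f. gd_isomorphism A B f)"

abbreviation e1 :: "complex^2" where "e1 \<equiv> axis 1 1"
abbreviation e2 :: "complex^2" where "e2 \<equiv> axis 2 1"

text \<open>The bilinear map taking the values \<open>v11\<close>, \<open>v12\<close>, \<open>v21\<close>, \<open>v22\<close> at
  \<open>(e1, e1)\<close>, \<open>(e1, e2)\<close>, \<open>(e2, e1)\<close>, \<open>(e2, e2)\<close>.\<close>

definition bilinear_of_table ::
    "complex^2 \<Rightarrow> complex^2 \<Rightarrow> complex^2 \<Rightarrow> complex^2 \<Rightarrow> complex^2 \<Rightarrow> complex^2 \<Rightarrow> complex^2"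
  where "bilinear_of_table v11 v12 v21 v22 x y =
    (x $ 1 * y $ 1) *s v11 + (x $ 1 * y $ 2) *s v12 + (x $ 2 * y $ 1) *s v21 + (x $ 2 * y $ 2) *s v22"

text \<open>The algebra on \<open>complex^2\<close> with \<open>ei \<circ> ej = pij\<close> and \<open>[e1, e2] = w\<close>.\<close>

definition gd_of_table ::
    "complex^2 \<Rightarrow> complex^2 \<Rightarrow> complex^2 \<Rightarrow> complex^2 \<Rightarrow> complex^2 \<Rightarrow> (complex, complex^2) gd_struct"
  where "gd_of_table p11 p12 p21 p22 w =
    \<lparr> scal = (*s), mul = bilinear_of_table p11 p12 p21 p22, brk = bilinear_of_table 0 w (- w) 0 \<rparr>"

text \<open>The families \<open>T1\<close> and \<open>T2\<close> are used only at the parameter values 0 and 1.\<close>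

definition T1 :: "complex \<Rightarrow> (complex, complex^2) gd_struct"
  where "T1 r = gd_of_table 0 0 0 0 (r *s e1)"

definition T2 :: "complex \<Rightarrow> (complex, complex^2) gd_struct"
  where "T2 r = gd_of_table 0 0 0 e1 (r *s e1)"

definition T3 :: "complex \<Rightarrow> (complex, complex^2) gd_struct"
  where "T3 r = gd_of_table 0 0 (- e1) 0 (r *s e1)"

definition N1 :: "(complex, complex^2) gd_struct"
  where "N1 = gd_of_table e1 0 0 e2 0"

definition N2 :: "(complex, complex^2) gd_struct"
  where "N2 = gd_of_table 0 0 0 e2 0"

definition N3 :: "complex \<Rightarrow> (complex, complex^2) gd_struct"
  where "N3 r = gd_of_table 0 e1 e1 e2 (r *s e1)"

definition N4 :: "complex \<Rightarrow> (complex, complex^2) gd_struct"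
  where "N4 r = gd_of_table 0 e1 0 e2 (r *s e1)"

definition N5 :: "complex \<Rightarrow> (complex, complex^2) gd_struct"
  where "N5 r = gd_of_table 0 e1 0 (e1 + e2) (r *s e1)"

definition N6 :: "complex \<Rightarrow> complex \<Rightarrow> (complex, complex^2) gd_struct"
  where "N6 l r = gd_of_table 0 e1 (l *s e1) e2 (r *s e1)"

end

theory Submission
  imports Defs
begin

text \<open>
  Right multiplications in a Novikov algebra commute, so over the complex numbers they have a common
  eigenvector. Taking it as the first basis vector of a two-dimensional algebra \<open>L\<close> leaves the table
  \<open>e1 \<circ> e1 = a e1\<close>, \<open>e1 \<circ> e2 = b e1\<close>, \<open>e2 \<circ> e1 = c e1 + d e2\<close>, \<open>e2 \<circ> e2 = p e1 + q e2\<close>,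
  \<open>[e1, e2] = \<alpha> e1 + \<beta> e2\<close> (\<open>isomorphic_triangular_table\<close>). On this table the axioms become a few quadratic
  equations (\<open>triangular_table_equations\<close>), and these split into four cases
  (\<open>triangular_table_classification\<close>):

  \<^item> \<open>d \<noteq> 0\<close>: then \<open>x \<circ> y = (a y\<^sub>1 + b y\<^sub>2) x\<close>, and a basis whose first vector spans the kernel of this
    functional of \<open>y\<close> gives \<open>N4\<close>.
  \<^item> \<open>d = 0\<close>, \<open>a \<noteq> 0\<close>: the product is commutative, \<open>e1 / a\<close> is an idempotent and the bracket vanishes,
    which gives \<open>N1\<close> or \<open>N2\<close>.
  \<^item> \<open>d = a = 0\<close>, \<open>q \<noteq> b\<close>: then \<open>b = c = 0\<close> and the bracket vanishes, which gives \<open>N2\<close>.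
  \<^item> \<open>d = a = 0\<close>, \<open>q = b\<close>: left and right multiplication by \<open>e2\<close> have the eigenvalues \<open>c\<close> and \<open>b\<close> at \<open>e1\<close>,
    and the remaining coefficient \<open>p\<close> can be removed by shifting \<open>e2\<close> along \<open>e1\<close> when \<open>c \<noteq> 0\<close>. Unless
    the product is zero, \<open>[e1, e2]\<close> is a multiple of \<open>e1\<close>. This gives the families \<open>T1\<close>, \<open>T2\<close>, \<open>T3\<close>,
    \<open>N3\<close>, \<open>N4\<close>, \<open>N5\<close> and \<open>N6\<close>.

  Conversely, isomorphisms preserve the traces of left multiplication, right multiplication and
  bracketing by an element. On the parametrised families these three traces are multiples of a single
  linear functional, so their ratios are invariants (\<open>triangular_table_iso_traces\<close>), and the
  parameters can be read off from the ratios.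
\<close>

section \<open>Coordinates with respect to a basis\<close>

definition lincomb2 :: "('k \<Rightarrow> 'a \<Rightarrow> 'a) \<Rightarrow> 'a \<Rightarrow> 'a \<Rightarrow> 'k^2 \<Rightarrow> 'a::ab_group_add"
  where "lincomb2 s u v x = s (x $ 1) u + s (x $ 2) v"

lemma linear_lincomb2:
  assumes "vector_space s"
  shows "Vector_Spaces.linear (*s) s (lincomb2 s u v)"
proof -
  interpret vector_space s by fact
  show ?thesis
    using assms
    by (auto simp: Vector_Spaces.linear_iff lincomb2_def vec.vector_space_axioms
        scale_left_distrib scale_right_distrib)
qed

lemma bilinear_mapD:
  assumes "bilinear_map s m"
  shows "m (x + x') y = m x y + m x' y" "m x (y + y') = m x y + m x y'"
    "m (s c x) y = s c (m x y)" "m x (s c y) = s c (m x y)"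
  using assms unfolding bilinear_map_def Vector_Spaces.linear_iff by simp_all

lemma bilinear_map_lincomb2:
  assumes "vector_space s" and "bilinear_map s m"
    and "lincomb2 s u v p11 = m u u" "lincomb2 s u v p12 = m u v"
    and "lincomb2 s u v p21 = m v u" "lincomb2 s u v p22 = m v v"
  shows "lincomb2 s u v (bilinear_of_table p11 p12 p21 p22 x y)
    = m (lincomb2 s u v x) (lincomb2 s u v y)"
proof -
  interpret vector_space s by fact
  interpret \<phi>: Vector_Spaces.linear "(*s)" s "lincomb2 s u v"
    by (rule linear_lincomb2) fact
  have "lincomb2 s u v (bilinear_of_table p11 p12 p21 p22 x y)
    = s (x$1 * y$1) (m u u) + s (x$1 * y$2) (m u v) + s (x$2 * y$1) (m v u) + s (x$2 * y$2) (m v v)"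
    unfolding bilinear_of_table_def by (simp add: \<phi>.add \<phi>.scale assms(3-6) del: vector_smult_assoc)
  also have "\<dots> = m (lincomb2 s u v x) (lincomb2 s u v y)"
    unfolding lincomb2_def[of s u v x] lincomb2_def[of s u v y]
    by (simp add: bilinear_mapD[OF assms(2)] scale_right_distrib algebra_simps)
  finally show ?thesis .
qed

text \<open>A structure that a linear bijection matches with a GD algebra inherits every axiom by transport, so no
  axiom has to be checked on the multiplication tables that arise from a change of basis.\<close>

lemma gd_isomorphic_of_bij:
  fixes A :: "('k::field, 'a::ab_group_add) gd_struct" and B :: "('k, 'b::ab_group_add) gd_struct"
  assumes A: "gd_algebra A"
    and \<phi>: "Vector_Spaces.linear (scal B) (scal A) \<phi>" "bij \<phi>"
    and mul: "\<And>x y. \<phi> (mul B x y) = mul A (\<phi> x) (\<phi> y)"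
    and brk: "\<And>x y. \<phi> (brk B x y) = brk A (\<phi> x) (\<phi> y)"
  shows "A \<cong> B"
proof -
  interpret gd_algebra A by fact
  interpret \<phi>: Vector_Spaces.linear "scal B" "scal A" \<phi> by fact
  have eq: "x = y" if "\<phi> x = \<phi> y" for x y
    using that \<phi>(2) by (metis bij_pointE)
  have "gd_algebra B"
  proof unfold_locales
    show "bilinear_map (scal B) (mul B)"
      unfolding bilinear_map_def Vector_Spaces.linear_iff
      by (auto intro!: eq \<phi>.vs1.vector_space_axioms
          simp: mul \<phi>.add \<phi>.scale bilinear_mapD[OF mul_bilinear])
    show "bilinear_map (scal B) (brk B)"
      unfolding bilinear_map_def Vector_Spaces.linear_iff
      by (auto intro!: eq \<phi>.vs1.vector_space_axioms
          simp: brk \<phi>.add \<phi>.scale bilinear_mapD[OF brk_bilinear])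
    show "mul B (mul B x y) z - mul B x (mul B y z) = mul B (mul B y x) z - mul B y (mul B x z)"
      for x y z
      by (rule eq) (simp add: mul \<phi>.diff left_symmetric)
    show "mul B (mul B x y) z = mul B (mul B x z) y" for x y z
      by (rule eq) (simp only: mul right_commutative)
    show "brk B x x = 0" for x
      by (rule eq) (simp add: brk brk_alternating)
    show "brk B x (brk B y z) + brk B y (brk B z x) + brk B z (brk B x y) = 0" for x y z
      by (rule eq) (simp add: brk \<phi>.add jacobi)
    show "brk B x (mul B y z) - brk B z (mul B y x) + mul B (brk B y x) z - mul B (brk B y z) x
      - mul B y (brk B x z) = 0" for x y z
      by (rule eq) (simp add: mul brk \<phi>.add \<phi>.diff gd_compatible)
  qed
  moreover have "Vector_Spaces.linear (scal A) (scal B) (inv \<phi>)"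
    unfolding Vector_Spaces.linear_iff
    by (auto intro!: eq \<phi>.vs1.vector_space_axioms novikov_vector_space
        simp: \<phi>.add \<phi>.scale bij_is_surj[OF \<phi>(2)] surj_f_inv_f)
  ultimately have "gd_isomorphism A B (inv \<phi>)"
    unfolding gd_isomorphism_def gd_isomorphism_axioms_def using A
    by (auto intro!: eq simp: mul brk bij_is_surj[OF \<phi>(2)] surj_f_inv_f bij_imp_bij_inv[OF \<phi>(2)])
  then show ?thesis
    unfolding gd_isomorphic_def by blast
qed

lemma gd_isomorphic_table_of_basis:
  fixes A :: "(complex, 'a::ab_group_add) gd_struct"
  assumes A: "gd_algebra A" and bij: "bij (lincomb2 (scal A) u v)"
    and mul: "lincomb2 (scal A) u v p11 = mul A u u" "lincomb2 (scal A) u v p12 = mul A u v"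
      "lincomb2 (scal A) u v p21 = mul A v u" "lincomb2 (scal A) u v p22 = mul A v v"
    and brk: "lincomb2 (scal A) u v w = brk A u v"
  shows "A \<cong> gd_of_table p11 p12 p21 p22 w"
proof -
  interpret gd_algebra A by fact
  let ?\<phi> = "lincomb2 (scal A) u v"
  have lin: "Vector_Spaces.linear (*s) (scal A) ?\<phi>"
    by (rule linear_lincomb2[OF novikov_vector_space])
  interpret \<phi>: Vector_Spaces.linear "(*s)" "scal A" ?\<phi> by (rule lin)
  have "brk A u u + brk A v u + (brk A u v + brk A v v) = 0"
    using brk_alternating[of "u + v"] by (simp only: bilinear_mapD[OF brk_bilinear])
  then have "brk A u v + brk A v u = 0"
    by (simp add: brk_alternating add.commute)
  then have "brk A v u = - brk A u v"
    using minus_unique by force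
  then have "?\<phi> (bilinear_of_table 0 w (- w) 0 x y) = brk A (?\<phi> x) (?\<phi> y)" for x y
    by (intro bilinear_map_lincomb2 lie_vector_space brk_bilinear)
      (simp_all add: brk_alternating brk \<phi>.neg)
  then show ?thesis
    using A bij lin mul
    by (intro gd_isomorphic_of_bij[where \<phi> = ?\<phi>])
      (auto simp: gd_of_table_def intro!: bilinear_map_lincomb2 novikov_vector_space mul_bilinear)
qed

text \<open>An arbitrary basis is enough: the point is only to move from the carrier of \<open>L\<close> to
  \<open>complex^2\<close>, where coordinates and matrices are available.\<close>

lemma dim_two_isomorphic_table:
  fixes L :: "(complex, 'a::ab_group_add) gd_struct"
  assumes L: "gd_algebra L" and dim: "gd_dim L = 2"
  obtains p11 p12 p21 p22 w where "L \<cong> gd_of_table p11 p12 p21 p22 w"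
proof -
  interpret gd_algebra L by fact
  interpret vector_space "scal L" by (rule novikov_vector_space)
  let ?\<phi> = "\<lambda>u v. lincomb2 (scal L) u v"
  obtain B where B: "independent B" "UNIV \<subseteq> span B" "card B = 2"
    using basis_exists[of UNIV] dim unfolding gd_dim_def by auto
  obtain u v where uv: "B = {u, v}" "u \<noteq> v"
    using B(3) by (auto simp: card_2_iff)
  have surj: "\<exists>x. y = ?\<phi> u v x" for y
  proof -
    have "y \<in> span {u, v}"
      using B(2) uv by auto
    then obtain a b where "y - scal L a u = scal L b v"
      by (auto simp: span_insert span_singleton)
    then have "y = ?\<phi> u v (vector [a, b])"
      by (simp add: lincomb2_def algebra_simps)
    then show ?thesis ..
  qed
  interpret \<phi>: Vector_Spaces.linear "(*s)" "scal L" "?\<phi> u v"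
    by (rule linear_lincomb2) unfold_locales
  have "x = 0" if "?\<phi> u v x = 0" for x
  proof -
    have x1: "x $ 1 = 0"
    proof (rule ccontr)
      assume "x $ 1 \<noteq> 0"
      moreover have "scal L (x $ 1) u \<in> span {v}"
        using that unfolding lincomb2_def
        by (metis add.commute add_diff_cancel_left' diff_0 insertI1 span_base span_neg span_scale)
      ultimately have "u \<in> span {v}"
        by (metis left_inverse scale_one scale_scale span_scale)
      then show False
        using B(1) uv by (simp add: independent_insert)
    qed
    moreover have "v \<noteq> 0"
      using B(1) uv dependent_zero by blast
    ultimately have "x $ 2 = 0"
      using that by (simp add: lincomb2_def)
    with x1 show "x = 0"
      by (simp add: vec_eq_iff forall_2)
  qed
  then have "inj (?\<phi> u v)"
    unfolding \<phi>.inj_iff_eq_0 by blast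
  with surj have "bij (?\<phi> u v)"
    unfolding bij_def surj_def by blast
  then show ?thesis
    using surj that gd_isomorphic_table_of_basis[OF L] by metis
qed

lemma gd_isomorphic_trans:
  assumes "A \<cong> B" and "B \<cong> C"
  shows "A \<cong> C"
proof -
  obtain f g where "gd_isomorphism A B f" "gd_isomorphism B C g"
    using assms unfolding gd_isomorphic_def by blast
  then have "gd_isomorphism A C (g \<circ> f)"
    unfolding gd_isomorphism_def gd_isomorphism_axioms_def
    by (auto intro: Vector_Spaces.linear_compose bij_comp)
  then show ?thesis
    unfolding gd_isomorphic_def by blast
qed

lemma bij_lincomb2_of_det:
  fixes u v :: "complex^2"
  assumes "u $ 1 * v $ 2 - u $ 2 * v $ 1 \<noteq> 0"
  shows "bij (lincomb2 (*s) u v)"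
proof -
  let ?D = "u $ 1 * v $ 2 - u $ 2 * v $ 1"
  \<comment> \<open>Cramer's rule.\<close>
  let ?g = "\<lambda>y. vector [(y$1 * v$2 - y$2 * v$1) / ?D, (u$1 * y$2 - u$2 * y$1) / ?D] :: complex^2"
  show ?thesis
  proof (rule o_bij[of ?g])
    show "?g \<circ> lincomb2 (*s) u v = id"
      using assms by (auto simp: fun_eq_iff vec_eq_iff forall_2 lincomb2_def divide_simps) algebra+
    show "lincomb2 (*s) u v \<circ> ?g = id"
      using assms by (auto simp: fun_eq_iff vec_eq_iff forall_2 lincomb2_def divide_simps) algebra+
  qed
qed

lemma table_change_of_basis:
  fixes u v :: "complex^2"
  assumes "gd_algebra A" and "scal A = (*s)"
    and "u $ 1 * v $ 2 - u $ 2 * v $ 1 \<noteq> 0"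
    and "mul A u u = q11 $ 1 *s u + q11 $ 2 *s v"
    and "mul A u v = q12 $ 1 *s u + q12 $ 2 *s v"
    and "mul A v u = q21 $ 1 *s u + q21 $ 2 *s v"
    and "mul A v v = q22 $ 1 *s u + q22 $ 2 *s v"
    and "brk A u v = w $ 1 *s u + w $ 2 *s v"
  shows "A \<cong> gd_of_table q11 q12 q21 q22 w"
  using assms bij_lincomb2_of_det[OF assms(3)]
  by (intro gd_isomorphic_table_of_basis[where u = u and v = v]) (auto simp: lincomb2_def)

section \<open>A common eigenvector of the right multiplications\<close>

lemma complex_quadratic_root:
  fixes b c :: complex
  obtains x where "x\<^sup>2 - b * x + c = 0"
proof
  let ?d = "csqrt (b\<^sup>2 - 4 * c)"
  show "((b + ?d) / 2)\<^sup>2 - b * ((b + ?d) / 2) + c = 0"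
    by (simp add: power2_eq_square field_simps) (use power2_csqrt[of "b\<^sup>2 - 4 * c"] in algebra)
qed

text \<open>The kernel of a nonzero functional on the plane is a line.\<close>

lemma parallel_of_common_functional:
  fixes x y :: "complex^2"
  assumes "x \<noteq> 0" and "a \<noteq> 0 \<or> b \<noteq> 0"
    and "a * x $ 1 + b * x $ 2 = 0" "a * y $ 1 + b * y $ 2 = 0"
  obtains \<mu> where "y = \<mu> *s x"
proof (cases "x $ 1 = 0")
  case True
  with assms(1) have "x $ 2 \<noteq> 0"
    by (auto simp: vec_eq_iff forall_2)
  with True assms have "y = (y $ 2 / x $ 2) *s x"
    by (auto simp: vec_eq_iff forall_2)
  then show ?thesis by (rule that)
next
  case False
  have "x $ 1 * y $ 2 = x $ 2 * y $ 1"
    using assms(2-4) by algebra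
  with False have "y = (y $ 1 / x $ 1) *s x"
    by (auto simp: vec_eq_iff forall_2 field_simps)
  then show ?thesis by (rule that)
qed

lemma complex_matrix2_eigenvector:
  fixes M :: "complex^2^2"
  obtains \<nu> x where "x \<noteq> 0" "M *v x = \<nu> *s x"
proof -
  obtain \<nu> where \<nu>: "\<nu>\<^sup>2 - trace M * \<nu> + det M = 0"
    by (rule complex_quadratic_root)
  then have "det (M - mat \<nu>) = 0"
    by (simp add: det_2 trace_def sum_2 mat_def power2_eq_square algebra_simps)
  then obtain x where "x \<noteq> 0" "(M - mat \<nu>) *v x = 0"
    by (metis invertible_det_nz matrix_left_invertible_ker invertible_left_inverse)
  then show ?thesis
    by (intro that[of x \<nu>]) (auto simp: matrix_vector_mult_def vec_eq_iff forall_2 sum_2 mat_def algebra_simps)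
qed

text \<open>Unless \<open>M\<close> is scalar, each of its eigenspaces is a line; a matrix that commutes with \<open>M\<close> preserves this
  line, so it has the same eigenvector.\<close>

lemma commuting_matrices2_common_eigenvector:
  fixes M N :: "complex^2^2"
  assumes "M ** N = N ** M"
  obtains \<nu> \<mu> x where "x \<noteq> 0" "M *v x = \<nu> *s x" "N *v x = \<mu> *s x"
proof -
  obtain \<nu> x where x: "x \<noteq> 0" "M *v x = \<nu> *s x"
    by (rule complex_matrix2_eigenvector)
  define K where "K = M - mat \<nu>"
  have K: "K *v y = M *v y - \<nu> *s y" for y
    by (simp add: K_def matrix_vector_mult_def vec_eq_iff forall_2 sum_2 mat_def algebra_simps)
  show ?thesis
  proof (cases "K = 0")
    case True
    obtain \<mu> y where "y \<noteq> 0" "N *v y = \<mu> *s y"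
      by (rule complex_matrix2_eigenvector)
    with K[of y] True that show ?thesis by simp
  next
    case False
    then obtain i where i: "K $ i $ 1 \<noteq> 0 \<or> K $ i $ 2 \<noteq> 0"
      by (auto simp: vec_eq_iff forall_2)
    have "M *v (N *v x) = N *v (M *v x)"
      by (simp add: matrix_vector_mul_assoc assms)
    also have "\<dots> = \<nu> *s (N *v x)"
      by (simp add: x(2) vector_scalar_commute)
    finally have "K *v (N *v x) = 0"
      by (simp add: K)
    moreover have "K *v x = 0"
      using x K by simp
    ultimately have "K $ i $ 1 * x $ 1 + K $ i $ 2 * x $ 2 = 0"
      "K $ i $ 1 * (N *v x) $ 1 + K $ i $ 2 * (N *v x) $ 2 = 0"
      by (simp_all add: matrix_vector_mult_def vec_eq_iff sum_2)
    with x i parallel_of_common_functional obtain \<mu> where "N *v x = \<mu> *s x"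
      by metis
    with x that show ?thesis by blast
  qed
qed

text \<open>The multiplication tables in which \<open>e1\<close> is an eigenvector of all right multiplications.\<close>

definition triangular_table ::
    "complex \<Rightarrow> complex \<Rightarrow> complex \<Rightarrow> complex \<Rightarrow> complex \<Rightarrow> complex \<Rightarrow> complex \<Rightarrow> complex \<Rightarrow>
      (complex, complex^2) gd_struct"
  where "triangular_table a b c d p q \<alpha> \<beta> =
    gd_of_table (a *s e1) (b *s e1) (c *s e1 + d *s e2) (p *s e1 + q *s e2) (\<alpha> *s e1 + \<beta> *s e2)"

lemma vec2_expand: "x = x $ 1 *s e1 + x $ 2 *s e2"
  by (simp add: vec_eq_iff forall_2 axis_def)

text \<open>By right commutativity the right multiplications commute. Their common eigenvector is the first basis
  vector, and any independent vector may serve as the second.\<close>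

lemma isomorphic_triangular_table:
  fixes A :: "(complex, complex^2) gd_struct"
  assumes A: "gd_algebra A" and scal: "scal A = (*s)"
  obtains a b c d p q \<alpha> \<beta> where "A \<cong> triangular_table a b c d p q \<alpha> \<beta>"
proof -
  interpret gd_algebra A by fact
  have mul: "bilinear_map (*s) (mul A)"
    using mul_bilinear scal by simp
  define R where "R x = matrix (\<lambda>y. mul A y x)" for x
  have R: "R x *v y = mul A y x" for x y
    unfolding R_def using mul by (intro matrix_works) (simp add: bilinear_map_def)
  have "R e1 ** R e2 = R e2 ** R e1"
    by (simp add: matrix_eq R right_commutative flip: matrix_vector_mul_assoc)
  then obtain k l u where u: "u \<noteq> 0" "mul A u e1 = k *s u" "mul A u e2 = l *s u"
    by (metis R commuting_matrices2_common_eigenvector)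
  have eigen: "mul A u x = (k * x $ 1 + l * x $ 2) *s u" for x
    by (subst vec2_expand[of x])
      (simp add: bilinear_mapD[OF mul] u(2,3) vec.scale_left_distrib mult.commute)
  define v where "v = (if u $ 1 = 0 then e1 else e2)"
  have "u $ 1 * v $ 2 - u $ 2 * v $ 1 \<noteq> 0"
    using u(1) by (auto simp: v_def axis_def vec_eq_iff forall_2)
  then have bij: "bij (lincomb2 (scal A) u v)"
    unfolding scal by (rule bij_lincomb2_of_det)
  then have surj: "\<exists>x. lincomb2 (scal A) u v x = y" for y
    by (metis bij_pointE)
  obtain x y z where xyz: "lincomb2 (scal A) u v x = mul A v u"
    "lincomb2 (scal A) u v y = mul A v v" "lincomb2 (scal A) u v z = brk A u v"
    using surj by metis
  have "A \<cong> gd_of_table ((k * u $ 1 + l * u $ 2) *s e1) ((k * v $ 1 + l * v $ 2) *s e1) x y z"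
    by (rule gd_isomorphic_table_of_basis[OF A bij])
      (simp_all only: xyz eigen, simp_all add: lincomb2_def scal axis_def)
  then show ?thesis
    using that unfolding triangular_table_def by (metis vec2_expand)
qed

section \<open>The classification\<close>

lemmas table_coords =
  gd_of_table_def bilinear_of_table_def vec_eq_iff forall_2 axis_def

text \<open>In dimension two the axioms only have content on few basis triples: right commutativity is symmetric in
  its last two arguments, left symmetry in its first two, and the GD condition is alternating in \<open>x\<close> and
  \<open>z\<close>. Moreover right commutativity is automatic when \<open>x\<close> is the common eigenvector \<open>e1\<close>.\<close>

lemma triangular_table_equations:
  assumes "A = triangular_table a b c d p q \<alpha> \<beta>" "gd_algebra A"
  shows "c * b + d * p = p * a + q * c"
    and "d * (d - a) = 0" "a * b - c * a - d * b = d * c"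
    and "b * b - p * a - q * b = d * p" "d * (q - b) = 0"
    and "a * \<alpha> + \<beta> * (b + c) = 0" "a * \<beta> = d * \<beta>"
    and "\<alpha> * (q - b) = 2 * \<beta> * p" "\<beta> * (c - q) = \<alpha> * d"
proof -
  interpret gd_algebra A by fact
  note defs = assms(1) triangular_table_def table_coords
  show "c * b + d * p = p * a + q * c"
    using right_commutative[of e2 e1 e2] by (simp add: defs algebra_simps)
  show "d * (d - a) = 0" "a * b - c * a - d * b = d * c"
    using left_symmetric[of e1 e2 e1] by (auto simp: defs algebra_simps)
  show "b * b - p * a - q * b = d * p" "d * (q - b) = 0"
    using left_symmetric[of e1 e2 e2] by (auto simp: defs algebra_simps)
  show "a * \<alpha> + \<beta> * (b + c) = 0" "a * \<beta> = d * \<beta>"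
    using gd_compatible[of e1 e1 e2] by (simp_all add: defs algebra_simps)
  show "\<alpha> * (q - b) = 2 * \<beta> * p" "\<beta> * (c - q) = \<alpha> * d"
    using gd_compatible[of e1 e2 e2] by (simp_all add: defs algebra_simps)
qed

definition normal_forms :: "(complex, complex^2) gd_struct set"
  where "normal_forms = {T1 0, T1 1, T2 0, T2 1, N1, N2} \<union> range T3 \<union> range N3 \<union> range N4 \<union> range N5
    \<union> {N6 l r | l r. l \<noteq> 0 \<and> l \<noteq> 1}"

text \<open>\<open>N3\<close> and \<open>N4\<close> are the members of the family \<open>N6\<close> at the values 1 and 0 that \<open>l\<close> avoids in the list of
  normal forms, so one computation serves all three families.\<close>

lemma N3_eq_N6: "N3 r = N6 1 r"
  by (simp add: N3_def N6_def)

lemma N4_eq_N6: "N4 r = N6 0 r"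
  by (simp add: N4_def N6_def)

lemma N6_in_normal_forms: "N6 l r \<in> normal_forms"
  unfolding normal_forms_def by (cases "l = 0"; cases "l = 1") (auto simp flip: N3_eq_N6 N4_eq_N6)

lemma triangular_change_of_basis:
  fixes u v :: "complex^2"
  assumes "A = triangular_table a b c d p q \<alpha> \<beta>" and "gd_algebra A"
    and "u $ 1 * v $ 2 - u $ 2 * v $ 1 \<noteq> 0"
    and "mul A u u = q11 $ 1 *s u + q11 $ 2 *s v"
    and "mul A u v = q12 $ 1 *s u + q12 $ 2 *s v"
    and "mul A v u = q21 $ 1 *s u + q21 $ 2 *s v"
    and "mul A v v = q22 $ 1 *s u + q22 $ 2 *s v"
    and "brk A u v = w $ 1 *s u + w $ 2 *s v"
  shows "A \<cong> gd_of_table q11 q12 q21 q22 w"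
  using assms by (intro table_change_of_basis) (auto simp: triangular_table_def gd_of_table_def)

text \<open>Only a Lie algebra remains. If it is not abelian, take \<open>[e1, e2]\<close> as the first basis vector and rescale
  an independent vector.\<close>

lemma zero_product_normal_form:
  assumes A: "A = triangular_table 0 0 0 0 0 0 \<alpha> \<beta>" "gd_algebra A"
  shows "A \<cong> T1 0 \<or> A \<cong> T1 1"
proof -
  note basis = triangular_change_of_basis[OF A]
  note defs = T1_def A(1) triangular_table_def table_coords
  consider "\<alpha> = 0" "\<beta> = 0" | "\<alpha> \<noteq> 0" | "\<alpha> = 0" "\<beta> \<noteq> 0" by blast
  then show ?thesis
  proof cases
    case 1
    then have "A \<cong> T1 0"
      unfolding T1_def by (intro basis[where u = e1 and v = e2]) (simp_all add: defs)
    then show ?thesis ..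
  next
    case 2
    then have "A \<cong> T1 1"
      unfolding T1_def
      by (intro basis[where u = "vector [\<alpha>, \<beta>]" and v = "vector [0, 1 / \<alpha>]"]) (simp_all add: defs)
    then show ?thesis ..
  next
    case 3
    then have "A \<cong> T1 1"
      unfolding T1_def
      by (intro basis[where u = "vector [0, \<beta>]" and v = "vector [- 1 / \<beta>, 0]"]) (simp_all add: defs)
    then show ?thesis ..
  qed
qed

lemma square_only_normal_form:
  assumes A: "A = triangular_table 0 0 0 0 p 0 \<alpha> 0" "gd_algebra A" and "p \<noteq> 0"
  shows "A \<cong> T2 0 \<or> A \<cong> T2 1"
proof -
  note basis = triangular_change_of_basis[OF A]
  note defs = T2_def A(1) triangular_table_def table_coords
  show ?thesis
  proof (cases "\<alpha> = 0")
    case True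
    then have "A \<cong> T2 0"
      unfolding T2_def using \<open>p \<noteq> 0\<close>
      by (intro basis[where u = "vector [p, 0]" and v = e2]) (simp_all add: defs)
    then show ?thesis ..
  next
    case False
    then have "A \<cong> T2 1"
      unfolding T2_def using \<open>p \<noteq> 0\<close>
      by (intro basis[where u = "vector [p / \<alpha>\<^sup>2, 0]" and v = "vector [0, 1 / \<alpha>]"])
        (simp_all add: defs power2_eq_square)
    then show ?thesis ..
  qed
qed

text \<open>The second vector \<open>- (e2 - (p / c) e1) / c\<close> has square zero.\<close>

lemma T3_normal_form:
  assumes A: "A = triangular_table 0 0 c 0 p 0 \<alpha> 0" "gd_algebra A" and "c \<noteq> 0"
  shows "A \<cong> T3 (- \<alpha> / c)"
  unfolding T3_def using \<open>c \<noteq> 0\<close>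
  by (intro triangular_change_of_basis[OF A, where u = e1 and v = "vector [p / c\<^sup>2, - 1 / c]"])
    (simp_all add: A(1) triangular_table_def table_coords power2_eq_square)

text \<open>For \<open>c \<noteq> 0\<close> the shift by \<open>- (p / c) e1\<close> makes the second vector idempotent. For \<open>c = 0 = p\<close> no shift
  is needed, and the formula gives none because division by zero yields zero.\<close>

lemma N6_normal_form:
  assumes A: "A = triangular_table 0 b c 0 p b \<alpha> 0" "gd_algebra A"
    and "b \<noteq> 0" and "c \<noteq> 0 \<or> p = 0"
  shows "A \<cong> N6 (c / b) (\<alpha> / b)"
  unfolding N6_def using assms(3,4)
  by (intro triangular_change_of_basis[OF A, where u = e1 and v = "vector [- p / (c * b), 1 / b]"])
    (auto simp: A(1) triangular_table_def table_coords field_simps)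

lemma N5_normal_form:
  assumes A: "A = triangular_table 0 b 0 0 p b \<alpha> 0" "gd_algebra A"
    and "b \<noteq> 0" and "p \<noteq> 0"
  shows "A \<cong> N5 (\<alpha> / b)"
  unfolding N5_def using assms(3,4)
  by (intro triangular_change_of_basis[OF A, where u = "vector [p / b\<^sup>2, 0]" and v = "vector [0, 1 / b]"])
    (auto simp: A(1) triangular_table_def table_coords power2_eq_square)

lemma N2_normal_form:
  assumes A: "A = triangular_table 0 0 0 0 p q 0 0" "gd_algebra A" and "q \<noteq> 0"
  shows "A \<cong> N2"
  unfolding N2_def using assms(3)
  by (intro triangular_change_of_basis[OF A, where u = e1 and v = "vector [p / q\<^sup>2, 1 / q]"])
    (auto simp: A(1) triangular_table_def table_coords power2_eq_square)

text \<open>The vector \<open>f = e2 - (b / a) e1\<close> is annihilated by \<open>e1\<close> and satisfies \<open>f \<circ> f = q f\<close>. Together with the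
  idempotent \<open>e1 / a\<close> it splits the algebra into two ideals of dimension one.\<close>

lemma commutative_idempotent_normal_form:
  assumes A: "A = triangular_table a b b 0 p q 0 0" "gd_algebra A"
    and "a \<noteq> 0" and p: "p * a = b * (b - q)"
  shows "A \<cong> N1 \<or> A \<cong> N2"
proof -
  note basis = triangular_change_of_basis[OF A]
  note defs = A(1) triangular_table_def table_coords
  have p: "p = b * (b - q) / a"
    using p \<open>a \<noteq> 0\<close> by (simp add: field_simps)
  show ?thesis
  proof (cases "q = 0")
    case True
    then have "A \<cong> N2"
      unfolding N2_def using \<open>a \<noteq> 0\<close>
      by (intro basis[where u = "vector [- b / a, 1]" and v = "vector [1 / a, 0]"])
        (simp_all add: defs p field_simps)
    then show ?thesis ..
  next
    case False
    then have "A \<cong> N1"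
      unfolding N1_def using \<open>a \<noteq> 0\<close>
      by (intro basis[where u = "vector [1 / a, 0]" and v = "vector [- b / (a * q), 1 / q]"])
        (simp_all add: defs p field_simps)
    then show ?thesis ..
  qed
qed

text \<open>Here \<open>x \<circ> y = \<chi>(y) x\<close> with \<open>\<chi>(y) = a y\<^sub>1 + b y\<^sub>2\<close>, so every vector is a common eigenvector. The first
  basis vector spans the kernel of \<open>\<chi>\<close>, and \<open>\<chi>\<close> takes the value 1 on the second. The condition on
  \<open>\<alpha>\<close> and \<open>\<beta>\<close> says that the bracket takes values in this kernel.\<close>

lemma scalar_right_multiplication_normal_form:
  assumes A: "A = triangular_table a b 0 a 0 b \<alpha> \<beta>" "gd_algebra A"
    and "a \<noteq> 0" and \<alpha>: "a * \<alpha> + b * \<beta> = 0"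
  shows "A \<cong> N6 0 (- \<beta> / a)"
proof -
  have "\<alpha> = - b * \<beta> / a"
    using \<alpha> \<open>a \<noteq> 0\<close> by (simp add: field_simps eq_neg_iff_add_eq_0)
  then show ?thesis
    unfolding N6_def using \<open>a \<noteq> 0\<close>
    by (intro triangular_change_of_basis[OF A, where u = "vector [b, - a]" and v = "vector [1 / a, 0]"])
      (simp_all add: A(1) triangular_table_def table_coords)
qed

lemma triangular_table_classification:
  assumes A: "A = triangular_table a b c d p q \<alpha> \<beta>" "gd_algebra A"
  shows "\<exists>B\<in>normal_forms. A \<cong> B"
proof -
  note eqs = triangular_table_equations[OF A]
  consider (scalar) "d \<noteq> 0" | (idempotent) "d = 0" "a \<noteq> 0"
    | (distinct) "d = 0" "a = 0" "q \<noteq> b" | (equal) "d = 0" "a = 0" "q = b"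
    by blast
  then show ?thesis
  proof cases
    case scalar
    then have "a = d" "q = b"
      using eqs by auto
    moreover have "c = 0" "p = 0"
      using eqs scalar calculation by auto
    ultimately have "A = triangular_table a b 0 a 0 b \<alpha> \<beta>"
      using A(1) by simp
    moreover have "a * \<alpha> + b * \<beta> = 0"
      using eqs(6) \<open>c = 0\<close> by (simp add: algebra_simps)
    ultimately have "A \<cong> N6 0 (- \<beta> / a)"
      using A(2) scalar \<open>a = d\<close> by (metis scalar_right_multiplication_normal_form)
    then show ?thesis
      using N6_in_normal_forms by blast
  next
    case idempotent
    then have "c = b" "\<beta> = 0"
      using eqs by auto
    moreover have "\<alpha> = 0"
      using eqs idempotent calculation by auto
    moreover have p: "p * a = b * (b - q)"
      using eqs idempotent by algebra
    ultimately have "A = triangular_table a b b 0 p q 0 0"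
      using A(1) idempotent by simp
    then have "A \<cong> N1 \<or> A \<cong> N2"
      using commutative_idempotent_normal_form A(2) idempotent p by blast
    then show ?thesis
      by (auto simp: normal_forms_def)
  next
    case distinct
    have "b * (b - q) = 0" "c * (b - q) = 0"
      using eqs distinct by algebra+
    then have "b = 0" "c = 0"
      using distinct by auto
    moreover have "\<beta> = 0"
      using eqs distinct calculation by auto
    moreover have "\<alpha> = 0"
      using eqs distinct calculation by auto
    ultimately have "A \<cong> N2"
      using A distinct by (auto intro!: N2_normal_form)
    then show ?thesis
      by (auto simp: normal_forms_def)
  next
    case equal
    show ?thesis
    proof (cases "b = 0 \<and> c = 0 \<and> p = 0")
      case True
      then have "A \<cong> T1 0 \<or> A \<cong> T1 1"
        using A equal by (intro zero_product_normal_form) auto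
      then show ?thesis
        by (auto simp: normal_forms_def)
    next
      case False
      \<comment> \<open>The equations give \<open>\<beta> (c + b) = 0\<close>, \<open>\<beta> (c - b) = 0\<close> and \<open>2 \<beta> p = 0\<close>.\<close>
      have "\<beta> * (2 * b) = 0" "\<beta> * (2 * c) = 0" "\<beta> * (2 * p) = 0"
        using eqs equal by algebra+
      then have \<beta>: "\<beta> = 0"
        using False by auto
      consider "b = 0" "c = 0" "p \<noteq> 0" | "b = 0" "c \<noteq> 0" | "b \<noteq> 0" "c \<noteq> 0 \<or> p = 0"
        | "b \<noteq> 0" "c = 0" "p \<noteq> 0"
        using False by blast
      then show ?thesis
      proof cases
        case 1
        then have "A \<cong> T2 0 \<or> A \<cong> T2 1"
          using A equal \<beta> by (intro square_only_normal_form) auto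
        then show ?thesis
          by (auto simp: normal_forms_def)
      next
        case 2
        then have "A = triangular_table 0 0 c 0 p 0 \<alpha> 0"
          using A(1) equal \<beta> by simp
        then have "A \<cong> T3 (- \<alpha> / c)"
          using A(2) \<open>c \<noteq> 0\<close> by (rule T3_normal_form)
        then show ?thesis
          by (auto simp: normal_forms_def)
      next
        case 3
        then have "A \<cong> N6 (c / b) (\<alpha> / b)"
          using A equal \<beta> N6_normal_form by auto
        then show ?thesis
          using N6_in_normal_forms by blast
      next
        case 4
        then have "A \<cong> N5 (\<alpha> / b)"
          using A equal \<beta> by (auto intro!: N5_normal_form)
        then show ?thesis
          by (auto simp: normal_forms_def)
      qed
    qed
  qed
qed

lemma gd_isomorphic_imp_gd_algebra: "A \<cong> B \<Longrightarrow> gd_algebra B"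
  unfolding gd_isomorphic_def gd_isomorphism_def by blast

lemma two_dimensional_classification:
  fixes L :: "(complex, 'a::ab_group_add) gd_struct"
  assumes "gd_algebra L" and "gd_dim L = 2"
  shows "\<exists>B\<in>normal_forms. L \<cong> B"
proof -
  obtain p11 p12 p21 p22 w where 1: "L \<cong> gd_of_table p11 p12 p21 p22 w"
    using dim_two_isomorphic_table[OF assms] by blast
  obtain a b c d p q \<alpha> \<beta> where
    2: "gd_of_table p11 p12 p21 p22 w \<cong> triangular_table a b c d p q \<alpha> \<beta>"
    by (rule isomorphic_triangular_table[OF gd_isomorphic_imp_gd_algebra[OF 1]])
      (simp add: gd_of_table_def)
  show ?thesis
    using triangular_table_classification[OF refl gd_isomorphic_imp_gd_algebra[OF 2]]
      gd_isomorphic_trans[OF gd_isomorphic_trans[OF 1 2]] by blast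
qed

section \<open>Traces separate the parameters\<close>

lemma trace_matrix_conj:
  fixes f g h :: "'k::field^'n \<Rightarrow> 'k^'n"
  assumes f: "Vector_Spaces.linear (*s) (*s) f" "bij f"
    and g: "Vector_Spaces.linear (*s) (*s) g" and h: "Vector_Spaces.linear (*s) (*s) h"
    and fg: "\<And>x. f (g x) = h (f x)"
  shows "trace (matrix g) = trace (matrix h)"
proof -
  define F where "F = matrix f"
  have F: "F *v x = f x" for x
    unfolding F_def by (rule matrix_works[OF f(1)])
  then have "inj ((*v) F)"
    using bij_is_inj[OF f(2)] by (simp add: inj_def)
  then obtain F' where F': "F' ** F = mat 1"
    by (metis matrix_left_invertible_injective)
  have "F ** matrix g = matrix h ** F"
    by (simp add: matrix_eq F matrix_works[OF g] matrix_works[OF h] fg flip: matrix_vector_mul_assoc)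
  then have "matrix g = F' ** (matrix h ** F)"
    by (metis F' matrix_mul_assoc matrix_mul_lid)
  also have "trace \<dots> = trace ((matrix h ** F) ** F')"
    by (rule trace_mul_sym)
  also have "\<dots> = trace (matrix h)"
    using F' by (metis matrix_left_right_inverse matrix_mul_assoc matrix_mul_rid)
  finally show ?thesis .
qed

text \<open>An isomorphism conjugates multiplication by \<open>x\<close>, on either side, into multiplication by \<open>f x\<close>.\<close>

lemma trace_bilinear_iso:
  fixes f :: "complex^2 \<Rightarrow> complex^2"
  assumes "bilinear_map (*s) m" "bilinear_map (*s) m'"
    and "Vector_Spaces.linear (*s) (*s) f" "bij f" and "\<And>x y. f (m x y) = m' (f x) (f y)"
  shows "trace (matrix (m x)) = trace (matrix (m' (f x)))"
    and "trace (matrix (\<lambda>y. m y x)) = trace (matrix (\<lambda>y. m' y (f x)))"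
  using assms by (auto intro!: trace_matrix_conj[of f] simp: bilinear_map_def)

lemma gd_iso_traces:
  fixes A B :: "(complex, complex^2) gd_struct"
  assumes "A \<cong> B" and s: "scal A = (*s)" "scal B = (*s)"
  obtains f where
    "\<And>x. trace (matrix (mul A x)) = trace (matrix (mul B (f x)))"
    "\<And>x. trace (matrix (\<lambda>y. mul A y x)) = trace (matrix (\<lambda>y. mul B y (f x)))"
    "\<And>x. trace (matrix (brk A x)) = trace (matrix (brk B (f x)))"
proof -
  obtain f where f: "gd_isomorphism A B f"
    using assms unfolding gd_isomorphic_def by blast
  interpret gd_isomorphism A B f by (rule f)
  note bil = dom.mul_bilinear cod.mul_bilinear dom.brk_bilinear cod.brk_bilinear iso_linear
  show ?thesis
    by (rule that[of f]; rule trace_bilinear_iso[OF _ _ _ iso_bij])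
      (use bil iso_mul iso_brk in \<open>simp_all add: s\<close>)
qed

lemma trace_bilinear_of_table:
  "trace (matrix (bilinear_of_table v11 v12 v21 v22 x))
    = x $ 1 * (v11 $ 1 + v12 $ 2) + x $ 2 * (v21 $ 1 + v22 $ 2)"
  "trace (matrix (\<lambda>y. bilinear_of_table v11 v12 v21 v22 y x))
    = x $ 1 * (v11 $ 1 + v21 $ 2) + x $ 2 * (v12 $ 1 + v22 $ 2)"
  by (simp_all add: trace_def matrix_def bilinear_of_table_def sum_2 axis_def algebra_simps)

text \<open>At an element \<open>x\<close> of the first algebra, the traces of left multiplication, right multiplication and bracket
  are \<open>(c + b) x\<^sub>2\<close>, \<open>2 b x\<^sub>2\<close> and \<open>- r x\<^sub>2\<close>. An isomorphism therefore rescales the triple \<open>(c + b, b, r)\<close>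
  by the second coordinate of the image of \<open>e2\<close>.\<close>

lemma triangular_table_iso_traces:
  assumes "triangular_table 0 b c 0 p b r 0 \<cong> triangular_table 0 b' c' 0 p' b' r' 0"
  obtains t where "c + b = t * (c' + b')" "b = t * b'" "r = t * r'"
proof -
  obtain f where f:
    "\<And>x. trace (matrix (mul (triangular_table 0 b c 0 p b r 0) x))
      = trace (matrix (mul (triangular_table 0 b' c' 0 p' b' r' 0) (f x)))"
    "\<And>x. trace (matrix (\<lambda>y. mul (triangular_table 0 b c 0 p b r 0) y x))
      = trace (matrix (\<lambda>y. mul (triangular_table 0 b' c' 0 p' b' r' 0) y (f x)))"
    "\<And>x. trace (matrix (brk (triangular_table 0 b c 0 p b r 0) x))
      = trace (matrix (brk (triangular_table 0 b' c' 0 p' b' r' 0) (f x)))"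
    by (rule gd_iso_traces[OF assms]) (simp_all add: triangular_table_def gd_of_table_def)
  show ?thesis
    using f[of e2] by (intro that[of "f e2 $ 2"])
      (simp_all add: triangular_table_def gd_of_table_def trace_bilinear_of_table axis_def)
qed

lemma N5_eq_triangular: "N5 r = triangular_table 0 1 0 0 1 1 r 0"
  by (simp add: N5_def triangular_table_def)

lemma N6_eq_triangular: "N6 l r = triangular_table 0 1 l 0 0 1 r 0"
  by (simp add: N6_def triangular_table_def)

lemma T3_eq_triangular: "T3 r = triangular_table 0 0 (- 1) 0 0 0 r 0"
  by (simp add: T3_def triangular_table_def)

lemma bilinear_of_table_bilinear: "bilinear_map (*s) (bilinear_of_table v11 v12 v21 v22)"
  unfolding bilinear_map_def Vector_Spaces.linear_iff
  by (auto simp: vec.vector_space_axioms bilinear_of_table_def vec_eq_iff algebra_simps)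

lemma triangular_table_gd_algebra: "gd_algebra (triangular_table 0 b c 0 p b r 0)"
  by unfold_locales
    (simp_all add: triangular_table_def gd_of_table_def bilinear_of_table_bilinear,
      simp_all add: bilinear_of_table_def vec_eq_iff forall_2 axis_def algebra_simps)

lemma gd_isomorphic_refl: "gd_algebra A \<Longrightarrow> A \<cong> A"
  by (rule gd_isomorphic_of_bij[where \<phi> = id])
    (auto simp: Vector_Spaces.linear_iff gd_algebra_def novikov_algebra_def)

text \<open>The scaling factor is 1 because the families fix a nonzero entry of the triple: \<open>b = 1\<close> for \<open>N5\<close> and
  \<open>N6\<close>, and \<open>c + b = - 1\<close> for \<open>T3\<close>.\<close>

lemma T3_iso_iff: "T3 r1 \<cong> T3 r2 \<longleftrightarrow> r1 = r2"
  unfolding T3_eq_triangular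
  by (auto elim!: triangular_table_iso_traces intro!: gd_isomorphic_refl triangular_table_gd_algebra)

lemma N5_iso_iff: "N5 r1 \<cong> N5 r2 \<longleftrightarrow> r1 = r2"
  unfolding N5_eq_triangular
  by (auto elim!: triangular_table_iso_traces intro!: gd_isomorphic_refl triangular_table_gd_algebra)

lemma N6_iso_iff: "N6 l1 r1 \<cong> N6 l2 r2 \<longleftrightarrow> l1 = l2 \<and> r1 = r2"
  unfolding N6_eq_triangular
  by (auto elim!: triangular_table_iso_traces intro!: gd_isomorphic_refl triangular_table_gd_algebra)

theorem theorem7p7:
  shows "(\<forall>L :: (complex, 'a::ab_group_add) gd_struct. gd_algebra L \<and> gd_dim L = 2 \<longrightarrow>
       L \<cong> T1 0 \<or> L \<cong> T1 1 \<or> L \<cong> T2 0 \<or> L \<cong> T2 1 \<or>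
       (\<exists>r. L \<cong> T3 r) \<or> L \<cong> N1 \<or> L \<cong> N2 \<or>
       (\<exists>r. L \<cong> N3 r) \<or> (\<exists>r. L \<cong> N4 r) \<or> (\<exists>r. L \<cong> N5 r) \<or>
       (\<exists>l r. l \<noteq> 0 \<and> l \<noteq> 1 \<and> L \<cong> N6 l r)) \<and>
    (\<forall>r1 r2. T3 r1 \<cong> T3 r2 \<longleftrightarrow> r1 = r2) \<and>
    (\<forall>r1 r2. N3 r1 \<cong> N3 r2 \<longleftrightarrow> r1 = r2) \<and>
    (\<forall>r1 r2. N4 r1 \<cong> N4 r2 \<longleftrightarrow> r1 = r2) \<and>
    (\<forall>r1 r2. N5 r1 \<cong> N5 r2 \<longleftrightarrow> r1 = r2) \<and>
    (\<forall>l1 r1 l2 r2. l1 \<noteq> 0 \<and> l1 \<noteq> 1 \<and> l2 \<noteq> 0 \<and> l2 \<noteq> 1 \<longrightarrow>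
       (N6 l1 r1 \<cong> N6 l2 r2 \<longleftrightarrow> l1 = l2 \<and> r1 = r2))"
proof (intro conjI)
  show "\<forall>L :: (complex, 'a) gd_struct. gd_algebra L \<and> gd_dim L = 2 \<longrightarrow>
       L \<cong> T1 0 \<or> L \<cong> T1 1 \<or> L \<cong> T2 0 \<or> L \<cong> T2 1 \<or>
       (\<exists>r. L \<cong> T3 r) \<or> L \<cong> N1 \<or> L \<cong> N2 \<or>
       (\<exists>r. L \<cong> N3 r) \<or> (\<exists>r. L \<cong> N4 r) \<or> (\<exists>r. L \<cong> N5 r) \<or>
       (\<exists>l r. l \<noteq> 0 \<and> l \<noteq> 1 \<and> L \<cong> N6 l r)"
  proof (intro allI impI)
    fix L :: "(complex, 'a) gd_struct"
    assume "gd_algebra L \<and> gd_dim L = 2"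
    then obtain B where "B \<in> normal_forms" "L \<cong> B"
      using two_dimensional_classification by blast
    then show "L \<cong> T1 0 \<or> L \<cong> T1 1 \<or> L \<cong> T2 0 \<or> L \<cong> T2 1 \<or>
       (\<exists>r. L \<cong> T3 r) \<or> L \<cong> N1 \<or> L \<cong> N2 \<or>
       (\<exists>r. L \<cong> N3 r) \<or> (\<exists>r. L \<cong> N4 r) \<or> (\<exists>r. L \<cong> N5 r) \<or>
       (\<exists>l r. l \<noteq> 0 \<and> l \<noteq> 1 \<and> L \<cong> N6 l r)"
      unfolding normal_forms_def by blast
  qed
qed (auto simp: T3_iso_iff N3_eq_N6 N4_eq_N6 N5_iso_iff N6_iso_iff)

end
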